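(* Let $M\ge1$. For every $i=0,1,\dots,M-1$, the quantity $\beta_i$ is conserved by the transformation $\varphi_0$; that is, writing $\tilde\beta_i$ for $\beta_i$ with each $q_0^{(j)},q_1^{(j)}$ replaced by $\tilde q_0^{(j)},\tilde q_1^{(j)}$, one has $\tilde\beta_i=\beta_i$.
   Context: Let $q_0^{(j)},q_1^{(j)}$ ($0\le j\le M-1$) and $e_0$ be independent indeterminates (or positive real numbers). Define $$\beta_0=1,\qquad \beta_i=\beta_{i-1}q_0^{(i)}+\prod_{j=0}^{i-1}q_1^{(j)}\quad(1\le i\le M-1).$$ The transformation $\varphi_0:(q_0^{(j)},q_1^{(j)},e_0)\mapsto(\tilde q_0^{(j)},\tilde q_1^{(j)},\tilde e_0)$ is defined as follows: put $e_0^{(0,0)}:=e_0$ and for $j=1,2,\dots,M$ $$e_0^{(0,j)}=\frac{e_0^{(0,j-1)}q_0^{(M-j)}}{e_0^{(0,j-1)}+q_1^{(M-j)}},\quad \tilde q_0^{(M-j)}=\frac{q_1^{(M-j)}q_0^{(M-j)}}{e_0^{(0,j-1)}+q_1^{(M-j)}},\quad \tilde q_1^{(M-j)}=e_0^{(0,j-1)}+q_1^{(M-j)},$$ and $\tilde e_0:=e_0^{(0,M)}$. *)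

theory Defs
  imports
    "HOL-Library.Poly_Mapping"
    "HOL-Computational_Algebra.Computational_Algebra"
begin

text \<open>
  The families of variables indexed by \<open>0 \<le> j \<le> M - 1\<close> are functions on \<open>nat\<close>;
  only their values below \<open>M\<close> are relevant.
\<close>

fun beta :: "(nat \<Rightarrow> 'a::field) \<Rightarrow> (nat \<Rightarrow> 'a) \<Rightarrow> nat \<Rightarrow> 'a" where
  "beta q0 q1 0 = 1"
| "beta q0 q1 (Suc i) = beta q0 q1 i * q0 (Suc i) + (\<Prod>j<Suc i. q1 j)"

text \<open>\<open>e_aux M q0 q1 e0 j\<close> is the auxiliary quantity \<open>e\<^sub>0\<^sup>(\<^sup>0\<^sup>,\<^sup>j\<^sup>)\<close>, for \<open>0 \<le> j \<le> M\<close>.\<close>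

fun e_aux :: "nat \<Rightarrow> (nat \<Rightarrow> 'a::field) \<Rightarrow> (nat \<Rightarrow> 'a) \<Rightarrow> 'a \<Rightarrow> nat \<Rightarrow> 'a" where
  "e_aux M q0 q1 e0 0 = e0"
| "e_aux M q0 q1 e0 (Suc j) =
     e_aux M q0 q1 e0 j * q0 (M - Suc j) / (e_aux M q0 q1 e0 j + q1 (M - Suc j))"

text \<open>
  The new variables carrying the index \<open>M - j\<close> (\<open>1 \<le> j \<le> M\<close>) are computed from
  \<open>e_aux M q0 q1 e0 (j - 1)\<close>. Putting \<open>k = M - j\<close>, so that \<open>j - 1 = M - Suc k\<close>,
  gives the following for \<open>k < M\<close>. The entries at \<open>k \<ge> M\<close> have no meaning.
\<close>

definition phi0 ::
    "nat \<Rightarrow> (nat \<Rightarrow> 'a::field) \<times> (nat \<Rightarrow> 'a) \<times> 'a \<Rightarrow> (nat \<Rightarrow> 'a) \<times> (nat \<Rightarrow> 'a) \<times> 'a" where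
  "phi0 M = (\<lambda>(q0, q1, e0).
     (\<lambda>k. q1 k * q0 k / (e_aux M q0 q1 e0 (M - Suc k) + q1 k),
      \<lambda>k. e_aux M q0 q1 e0 (M - Suc k) + q1 k,
      e_aux M q0 q1 e0 M))"

text \<open>
  Rational functions over a field \<open>'k\<close> in indeterminates indexed by \<open>nat\<close>: the
  fraction field of the polynomial ring, whose elements are finitely supported functions
  from monomials (finitely supported exponent vectors) to coefficients. The indeterminate
  with number \<open>0\<close> serves as \<open>e\<^sub>0\<close>, the odd ones as \<open>q\<^sub>0\<^sup>(\<^sup>j\<^sup>)\<close> and the even
  positive ones as \<open>q\<^sub>1\<^sup>(\<^sup>j\<^sup>)\<close>.
\<close>

type_synonym 'k ratfun = "((nat \<Rightarrow>\<^sub>0 nat) \<Rightarrow>\<^sub>0 'k) fract"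

definition indet :: "nat \<Rightarrow> 'k::field ratfun" where
  "indet n = to_fract (Poly_Mapping.single (Poly_Mapping.single n 1) 1)"

definition indet_e0 :: "'k::field ratfun" where
  "indet_e0 = indet 0"

definition indet_q0 :: "nat \<Rightarrow> 'k::field ratfun" where
  "indet_q0 j = indet (2 * j + 1)"

definition indet_q1 :: "nat \<Rightarrow> 'k::field ratfun" where
  "indet_q1 j = indet (2 * j + 2)"

end

theory Submission
  imports Defs
begin

text \<open>
  Let \<open>F\<^sub>k = e\<^sub>0\<^sup>(\<^sup>0\<^sup>,\<^sup>M\<^sup>-\<^sup>1\<^sup>-\<^sup>k\<^sup>)\<close> be the carry entering at index \<open>k\<close>, and write \<open>p\<^sub>0, p\<^sub>1\<close> for the
  transformed variables. Then \<open>p\<^sub>0 k + F\<^bsub>k-1\<^esub> = q\<^sub>0 k\<close>, and by induction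
  \<open>(\<Prod>j\<le>i. p\<^sub>1 j) = (\<Prod>j\<le>i. q\<^sub>1 j) + \<beta>\<^sub>i F\<^sub>i\<close>; the two corrections cancel in the recursion for \<open>\<beta>\<close>.
  This needs the denominators \<open>F\<^sub>k + q\<^sub>1 k\<close> to be nonzero. For indeterminates over an arbitrary
  field, \<open>F\<^sub>k\<close> is a monomial free of the \<open>q\<^sub>1\<close> divided by a polynomial \<open>d\<close>, and this monomial
  cannot be cancelled by \<open>q\<^sub>1 k * d\<close>.
\<close>

lemma beta_conserved:
  fixes q0 q1 p0 p1 F :: "nat \<Rightarrow> 'a::field"
  assumes nz: "\<And>k. k < M \<Longrightarrow> F k + q1 k \<noteq> 0"
    and F: "\<And>k. Suc k < M \<Longrightarrow> F k = F (Suc k) * q0 (Suc k) / (F (Suc k) + q1 (Suc k))"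
    and p0: "\<And>k. k < M \<Longrightarrow> p0 k = q1 k * q0 k / (F k + q1 k)"
    and p1: "\<And>k. k < M \<Longrightarrow> p1 k = F k + q1 k"
    and "i < M"
  shows "beta p0 p1 i = beta q0 q1 i \<and>
    (\<Prod>j<Suc i. p1 j) = (\<Prod>j<Suc i. q1 j) + beta q0 q1 i * F i"
  using \<open>i < M\<close>
proof (induction i)
  case 0
  then show ?case by (simp add: p1)
next
  case (Suc i)
  define P where "P = (\<Prod>j<Suc i. q1 j)"
  have IH: "beta p0 p1 i = beta q0 q1 i" "(\<Prod>j<Suc i. p1 j) = P + beta q0 q1 i * F i"
    using Suc by (simp_all add: P_def)
  have D: "F (Suc i) + q1 (Suc i) \<noteq> 0"
    using nz Suc.prems by blast
  have F_mult: "F i * (F (Suc i) + q1 (Suc i)) = F (Suc i) * q0 (Suc i)"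
    using F[OF Suc.prems] D by simp
  \<comment> \<open>Both fractions have denominator \<open>F (Suc i) + q1 (Suc i)\<close>, and their
    numerators add up to \<open>q0 (Suc i)\<close> times it.\<close>
  have p0_plus: "p0 (Suc i) + F i = q0 (Suc i)"
    using D by (simp add: p0[OF Suc.prems] F[OF Suc.prems] add_divide_distrib [symmetric])
      (simp add: field_simps)
  have beta_q: "beta q0 q1 (Suc i) = beta q0 q1 i * q0 (Suc i) + P"
    by (simp only: beta.simps P_def)
  have "beta p0 p1 (Suc i) = beta q0 q1 i * (p0 (Suc i) + F i) + P"
    unfolding beta.simps IH by (simp add: algebra_simps)
  then have beta_eq: "beta p0 p1 (Suc i) = beta q0 q1 (Suc i)"
    by (simp only: beta_q p0_plus)
  have "(\<Prod>j<Suc (Suc i). p1 j) = (P + beta q0 q1 i * F i) * (F (Suc i) + q1 (Suc i))"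
    using IH(2) p1[OF Suc.prems] by (simp only: prod.lessThan_Suc [of _ "Suc i"])
  also have "\<dots> = P * (F (Suc i) + q1 (Suc i)) + beta q0 q1 i * (F i * (F (Suc i) + q1 (Suc i)))"
    by (simp only: distrib_right mult.assoc)
  \<comment> \<open>\<open>F_mult\<close> trades the old carry \<open>F i\<close> for the new one;
    the coefficient collected at \<open>F (Suc i)\<close> is exactly the recursion for
    \<open>beta\<close> at \<open>Suc i\<close>.\<close>
  also have "\<dots> = P * q1 (Suc i) + (beta q0 q1 i * q0 (Suc i) + P) * F (Suc i)"
    unfolding F_mult by (simp add: algebra_simps)
  also have "\<dots> = (\<Prod>j<Suc (Suc i). q1 j) + beta q0 q1 (Suc i) * F (Suc i)"
    unfolding beta_q by (simp only: prod.lessThan_Suc [of _ "Suc i"] P_def)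
  finally show ?case using beta_eq by blast
qed

lemma beta_phi0:
  assumes "phi0 M (q0, q1, e0) = (p0, p1, e1)" and "i < M"
    and nz: "\<And>k. k < M \<Longrightarrow> e_aux M q0 q1 e0 (M - Suc k) + q1 k \<noteq> 0"
  shows "beta p0 p1 i = beta q0 q1 i"
proof -
  let ?F = "\<lambda>k. e_aux M q0 q1 e0 (M - Suc k)"
  have "?F k = ?F (Suc k) * q0 (Suc k) / (?F (Suc k) + q1 (Suc k))" if "Suc k < M" for k
  proof -
    \<comment> \<open>The steps of \<open>e_aux\<close> count up while the indices run down from
      \<open>M - 1\<close>: step \<open>M - Suc k\<close> is the one that uses index
      \<open>Suc k\<close>.\<close>
    have "M - Suc k = Suc (M - Suc (Suc k))" "M - Suc (M - Suc (Suc k)) = Suc k"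
      using that by auto
    then show ?thesis by simp
  qed
  then show ?thesis
    using beta_conserved [of M ?F q1 q0 p0 p1 i] assms by (auto simp: phi0_def)
qed

lemma e_aux_pos:
  fixes q0 q1 :: "nat \<Rightarrow> real"
  assumes "\<And>j. j < M \<Longrightarrow> q0 j > 0 \<and> q1 j > 0" and "e0 > 0" and "j \<le> M"
  shows "e_aux M q0 q1 e0 j > 0"
  using \<open>j \<le> M\<close>
  by (induction j) (auto simp: assms intro!: divide_pos_pos mult_pos_pos add_pos_pos)

text \<open>Every monomial of a multiple of the indeterminate \<open>v\<close> contains
  \<open>v\<close>, but \<open>m\<close> does not. So nothing can cancel the coefficient 1 at
  \<open>m\<close>, in any characteristic.\<close>

lemma monomial_plus_multiple_nonzero:
  fixes d :: "('v \<Rightarrow>\<^sub>0 nat) \<Rightarrow>\<^sub>0 'k::field"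
  assumes "Poly_Mapping.lookup m v = 0"
  shows "Poly_Mapping.single m 1 + Poly_Mapping.single (Poly_Mapping.single v 1) 1 * d \<noteq> 0"
    (is "?m + ?x * d \<noteq> 0")
proof
  assume "?m + ?x * d = 0"
  then have "Poly_Mapping.lookup (?m + ?x * d) m = 0" by simp
  then have "m \<in> Poly_Mapping.keys (?x * d)"
    by (auto simp: lookup_add in_keys_iff)
  then obtain b where "m = Poly_Mapping.single v 1 + b"
    using keys_mult [of ?x d] by auto
  with assms show False by (simp add: lookup_add)
qed

text \<open>An invariant of the recursion: a step multiplies the numerator only by some
  \<open>indet_q0 k\<close>, so it stays a monomial free of the indeterminates numbered
  \<open>2 * k + 2\<close>, which are the \<open>indet_q1 k\<close>. All sums go into
  \<open>d\<close>, which may contain them.\<close>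

lemma e_aux_indet:
  fixes M j :: nat
  defines "E \<equiv> e_aux M indet_q0 indet_q1 (indet_e0 :: 'k::field ratfun) j"
  shows "\<exists>m d. d \<noteq> 0 \<and> (\<forall>k. Poly_Mapping.lookup m (2 * k + 2) = 0) \<and>
    E = to_fract (Poly_Mapping.single m 1) / to_fract d"
  unfolding E_def
proof (induction j)
  case 0
  show ?case
    by (rule exI [of _ "Poly_Mapping.single 0 1"], rule exI [of _ 1])
      (simp add: indet_e0_def indet_def lookup_single)
next
  case (Suc j)
  then obtain m d where d: "d \<noteq> 0" and m: "\<And>k. Poly_Mapping.lookup m (2 * k + 2) = 0"
    and E: "e_aux M indet_q0 indet_q1 (indet_e0 :: 'k ratfun) j
      = to_fract (Poly_Mapping.single m 1) / to_fract d" by blast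
  define k where "k = M - Suc j"
  \<comment> \<open>With x the monomial of \<open>m\<close>, clearing \<open>d\<close> from (x/d) q0
    / (x/d + q1) leaves x q0 / (x + q1 d): \<open>m'\<close> is the exponent vector of the
    numerator, \<open>d'\<close> the denominator.\<close>
  define d' where "d' = Poly_Mapping.single m 1
      + Poly_Mapping.single (Poly_Mapping.single (2 * k + 2) 1) 1 * d"
  define m' where "m' = m + Poly_Mapping.single (2 * k + 1) 1"
  have d': "d' \<noteq> 0"
    unfolding d'_def by (rule monomial_plus_multiple_nonzero [OF m])
  have m': "\<forall>l. Poly_Mapping.lookup m' (2 * l + 2) = 0"
  proof
    fix l
    have "2 * k + 1 \<noteq> 2 * l + 2" by presburger
    then show "Poly_Mapping.lookup m' (2 * l + 2) = 0"
      using m [of l] by (simp add: m'_def lookup_add lookup_single)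
  qed
  have num: "to_fract (Poly_Mapping.single m 1) * indet_q0 k
      = (to_fract (Poly_Mapping.single m' 1) :: 'k ratfun)"
    by (simp add: m'_def indet_q0_def indet_def mult_single flip: to_fract_mult)
  have den: "to_fract (Poly_Mapping.single m 1) + indet_q1 k * to_fract d = to_fract d'"
    by (simp add: d'_def indet_q1_def indet_def)
  have "e_aux M indet_q0 indet_q1 (indet_e0 :: 'k ratfun) (Suc j)
      = to_fract (Poly_Mapping.single m 1) * indet_q0 k
        / (to_fract (Poly_Mapping.single m 1) + indet_q1 k * to_fract d)"
    using d by (simp add: E flip: k_def) (simp add: divide_simps)
  then show ?case
    unfolding num den using d' m' by blast
qed

lemma e_aux_indet_plus_nonzero:
  "e_aux M indet_q0 indet_q1 (indet_e0 :: 'k::field ratfun) j + indet_q1 k \<noteq> 0"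
proof -
  obtain m d where d: "d \<noteq> 0" and m: "Poly_Mapping.lookup m (2 * k + 2) = 0"
    and E: "e_aux M indet_q0 indet_q1 (indet_e0 :: 'k ratfun) j
      = to_fract (Poly_Mapping.single m 1) / to_fract d"
    using e_aux_indet by blast
  \<comment> \<open>This is the numerator of the sum in the claim over the denominator
    \<open>d\<close>.\<close>
  have "to_fract (Poly_Mapping.single m 1) + indet_q1 k * to_fract d \<noteq> (0 :: 'k ratfun)"
    using monomial_plus_multiple_nonzero [OF m, of d]
    by (simp add: indet_q1_def indet_def flip: to_fract_mult to_fract_add)
  then show ?thesis
    using d by (simp add: E add_divide_eq_iff divide_add_eq_iff)
qed

theorem proposition4p3:
  fixes M i :: nat
  assumes "M \<ge> 1" and "i \<le> M - 1"
  shows "(\<forall>tq0 tq1 te0.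
            phi0 M (indet_q0, indet_q1, indet_e0 :: 'k::field ratfun) = (tq0, tq1, te0)
              \<longrightarrow> beta tq0 tq1 i = beta indet_q0 indet_q1 i)
       \<and> (\<forall>(q0 :: nat \<Rightarrow> real) (q1 :: nat \<Rightarrow> real) (e0 :: real) tq0 tq1 te0.
            (\<forall>j<M. q0 j > 0 \<and> q1 j > 0) \<and> e0 > 0 \<and> phi0 M (q0, q1, e0) = (tq0, tq1, te0)
              \<longrightarrow> beta tq0 tq1 i = beta q0 q1 i)"
proof (intro conjI allI impI)
  have i: "i < M" using assms by simp
  {
    fix tq0 tq1 and te0 :: "'k ratfun"
    assume "phi0 M (indet_q0, indet_q1, indet_e0) = (tq0, tq1, te0)"
    then show "beta tq0 tq1 i = beta indet_q0 indet_q1 i"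
      using i e_aux_indet_plus_nonzero by (rule beta_phi0)
  next
    fix q0 q1 :: "nat \<Rightarrow> real" and e0 :: real and tq0 tq1 te0
    assume A: "(\<forall>j<M. q0 j > 0 \<and> q1 j > 0) \<and> e0 > 0 \<and> phi0 M (q0, q1, e0) = (tq0, tq1, te0)"
    have "e_aux M q0 q1 e0 (M - Suc k) + q1 k \<noteq> 0" if "k < M" for k
      using e_aux_pos [of M q0 q1 e0 "M - Suc k"] A that by (smt (verit) diff_le_self)
    then show "beta tq0 tq1 i = beta q0 q1 i"
      using beta_phi0 A i by blast
  }
qed

end
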